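(* For any integer $n\ge 2$, there exist a Hilbert space $H$ and $T\in\mathcal{L}(H)$ such that $T$ is $n$-centered, whereas $T$ is not $(n+1)$-centered.
   Context: For a (complex) Hilbert space $H$, $\mathcal{L}(H)$ is the set of bounded linear operators on $H$. For $T\in\mathcal{L}(H)$, $|T|=(T^*T)^{1/2}$, $\mathcal{R}(T)$ is the range of $T$, and $P_M$ is the orthogonal projection onto a closed subspace $M$. An element $U\in\mathcal{L}(H)$ is a partial isometry if $U^*U$ is a projection. "$T=U|T|$ is the polar decomposition of $T$" means: $U\in\mathcal{L}(H)$ is a partial isometry, $T=U|T|$, and $U^*U=P_{\overline{\mathcal{R}(T^* )}}$. If $T$ has the polar decomposition $T=U|T|$ and $n$ is a positive integer, then $T$ is called $n$-centered if $T^k=U^k|T^k|$ is the polar decomposition of $T^k$ for $k=1,2,\dots,n$. *)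

theory Defs
  imports
    "HOL-Analysis.Analysis"
    "HOL-Algebra.Module"
    "HOL-Algebra.Algebraic_Closure_Type"
begin

text \<open>
  Spaces carry an explicit carrier set, so that a formula can assert the existence of a Hilbert
  space. The fields \<open>mult\<close> and \<open>one\<close> inherited through the record of modules have no meaning here.
\<close>

record 'a cinner_module = "(complex, 'a) module" +
  cinner :: "'a \<Rightarrow> 'a \<Rightarrow> complex"

definition hnorm :: "('a, 'm) cinner_module_scheme \<Rightarrow> 'a \<Rightarrow> real" where
  "hnorm H x = sqrt (Re (cinner H x x))"

text \<open>
  The locale \<^locale>\<open>Metric_space\<close> demands symmetry and nonnegativity of the distance also off the
  carrier, hence the case distinction.
\<close>

definition hdist :: "('a, 'm) cinner_module_scheme \<Rightarrow> 'a \<Rightarrow> 'a \<Rightarrow> real" where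
  "hdist H x y = (if x \<in> carrier H \<and> y \<in> carrier H then hnorm H (x \<ominus>\<^bsub>H\<^esub> y) else 0)"

locale complex_inner_product_space =
  Module.module "ring_of_type_algebra :: complex ring" H
  for H :: "('a, 'm) cinner_module_scheme" (structure) +
  assumes cinner_add_left:
      "\<lbrakk>x \<in> carrier H; y \<in> carrier H; z \<in> carrier H\<rbrakk> \<Longrightarrow>
        cinner H (x \<oplus>\<^bsub>H\<^esub> y) z = cinner H x z + cinner H y z"
    and cinner_smult_left:
      "\<lbrakk>x \<in> carrier H; y \<in> carrier H\<rbrakk> \<Longrightarrow> cinner H (c \<odot>\<^bsub>H\<^esub> x) y = c * cinner H x y"
    and cinner_commute:
      "\<lbrakk>x \<in> carrier H; y \<in> carrier H\<rbrakk> \<Longrightarrow> cinner H x y = cnj (cinner H y x)"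
    and cinner_nonneg: "x \<in> carrier H \<Longrightarrow> cinner H x x \<in> \<real>\<^sub>\<ge>\<^sub>0"
    and cinner_definite: "\<lbrakk>x \<in> carrier H; cinner H x x = 0\<rbrakk> \<Longrightarrow> x = \<zero>\<^bsub>H\<^esub>"
begin

lemma cinner_minus_left:
  assumes "x \<in> carrier H" "y \<in> carrier H" "z \<in> carrier H"
  shows "cinner H (x \<ominus>\<^bsub>H\<^esub> y) z = cinner H x z - cinner H y z"
proof -
  have "(x \<ominus>\<^bsub>H\<^esub> y) \<oplus>\<^bsub>H\<^esub> y = x"
    using assms by (simp add: M.minus_eq M.a_assoc M.l_neg)
  then have "cinner H x z = cinner H (x \<ominus>\<^bsub>H\<^esub> y) z + cinner H y z"
    using assms cinner_add_left[of "x \<ominus>\<^bsub>H\<^esub> y" y z] by (simp add: M.minus_closed)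
  then show ?thesis by simp
qed

lemma cinner_minus_right:
  assumes "x \<in> carrier H" "y \<in> carrier H" "z \<in> carrier H"
  shows "cinner H z (x \<ominus>\<^bsub>H\<^esub> y) = cinner H z x - cinner H z y"
  using assms cinner_minus_left[of x y z] cinner_commute[of z]
  by (simp add: M.minus_closed)

lemma smult_closed': "x \<in> carrier H \<Longrightarrow> c \<odot>\<^bsub>H\<^esub> x \<in> carrier H"
  by (rule smult_closed) (simp_all add: ring_of_type_algebra_def)

lemma cinner_smult_right:
  assumes "x \<in> carrier H" "y \<in> carrier H"
  shows "cinner H x (c \<odot>\<^bsub>H\<^esub> y) = cnj c * cinner H x y"
  using assms cinner_commute[of x] cinner_smult_left[of y x c] by (simp add: smult_closed')

lemma cinner_self: "x \<in> carrier H \<Longrightarrow> cinner H x x = of_real ((hnorm H x)\<^sup>2)"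
  using cinner_nonneg[of x] by (auto simp: complex_nonneg_Reals_iff hnorm_def complex_eq_iff)

lemma hnorm_nonneg: "x \<in> carrier H \<Longrightarrow> 0 \<le> hnorm H x"
  using cinner_nonneg[of x] by (auto simp: complex_nonneg_Reals_iff hnorm_def)

lemma hnorm_eq_0: "x \<in> carrier H \<Longrightarrow> hnorm H x = 0 \<longleftrightarrow> x = \<zero>\<^bsub>H\<^esub>"
proof
  assume "x \<in> carrier H" "hnorm H x = 0"
  then show "x = \<zero>\<^bsub>H\<^esub>" using cinner_self[of x] cinner_definite by simp
next
  assume "x = \<zero>\<^bsub>H\<^esub>"
  moreover have "cinner H \<zero>\<^bsub>H\<^esub> \<zero>\<^bsub>H\<^esub> = 0"
    using cinner_add_left[of "\<zero>\<^bsub>H\<^esub>" "\<zero>\<^bsub>H\<^esub>" "\<zero>\<^bsub>H\<^esub>"] by simp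
  ultimately show "hnorm H x = 0" by (simp add: hnorm_def)
qed

lemma Cauchy_Schwarz:
  assumes x: "x \<in> carrier H" and y: "y \<in> carrier H"
  shows "cmod (cinner H x y) \<le> hnorm H x * hnorm H y"
proof (cases "hnorm H y = 0")
  case True
  then have "y = \<zero>\<^bsub>H\<^esub>" using y hnorm_eq_0 by simp
  moreover have "cinner H \<zero>\<^bsub>H\<^esub> x = 0"
    using cinner_add_left[of "\<zero>\<^bsub>H\<^esub>" "\<zero>\<^bsub>H\<^esub>" x] x by simp
  ultimately have "cinner H x y = 0" using x y cinner_commute[of x y] by simp
  then show ?thesis using True by simp
next
  case False
  define b where "b = (hnorm H y)\<^sup>2"
  define a where "a = cinner H x y"
  define c where "c = a / of_real b"
  define w where "w = x \<ominus>\<^bsub>H\<^esub> (c \<odot>\<^bsub>H\<^esub> y)"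
  have b: "b > 0" using False by (simp add: b_def)
  have cy: "c \<odot>\<^bsub>H\<^esub> y \<in> carrier H" using y by (rule smult_closed')
  have w: "w \<in> carrier H" using x cy by (simp add: w_def M.minus_closed)
  have "cinner H w w = of_real ((hnorm H x)\<^sup>2) - cnj c * a - c * cnj a + c * cnj c * of_real b"
    using x y cy w cinner_commute[of y x] unfolding w_def
    by (simp add: cinner_minus_left cinner_minus_right cinner_smult_left cinner_smult_right
        M.minus_closed cinner_self[OF x] cinner_self[OF y] a_def b_def algebra_simps)
  also have "\<dots> = of_real ((hnorm H x)\<^sup>2 - (cmod a)\<^sup>2 / b)"
    using b complex_norm_square[of a] by (simp add: c_def field_simps)
  finally have "(hnorm H w)\<^sup>2 = (hnorm H x)\<^sup>2 - (cmod a)\<^sup>2 / b"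
    using cinner_self[OF w] by (metis of_real_eq_iff)
  then have "(cmod a)\<^sup>2 / b \<le> (hnorm H x)\<^sup>2" by (metis diff_ge_0_iff_ge zero_le_power2)
  then have "(cmod a)\<^sup>2 \<le> (hnorm H x * hnorm H y)\<^sup>2"
    using b by (simp add: field_simps b_def)
  then show ?thesis
    unfolding a_def by (rule power2_le_imp_le) (simp add: hnorm_nonneg x y)
qed

lemma hnorm_triangle:
  assumes x: "x \<in> carrier H" and y: "y \<in> carrier H"
  shows "hnorm H (x \<oplus>\<^bsub>H\<^esub> y) \<le> hnorm H x + hnorm H y"
proof (rule power2_le_imp_le)
  have xy: "x \<oplus>\<^bsub>H\<^esub> y \<in> carrier H" using x y by simp
  have r: "cinner H z (x \<oplus>\<^bsub>H\<^esub> y) = cinner H z x + cinner H z y" if "z \<in> carrier H" for z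
    using that x y xy cinner_commute[of z] cinner_add_left[of x y z] by simp
  have "cinner H (x \<oplus>\<^bsub>H\<^esub> y) (x \<oplus>\<^bsub>H\<^esub> y) =
      cinner H x x + cinner H x y + cnj (cinner H x y) + cinner H y y"
    using x y xy cinner_commute[of y x] by (simp add: cinner_add_left r)
  then have "(hnorm H (x \<oplus>\<^bsub>H\<^esub> y))\<^sup>2 = (hnorm H x)\<^sup>2 + 2 * Re (cinner H x y) + (hnorm H y)\<^sup>2"
    using cinner_self[OF x] cinner_self[OF y] cinner_self[OF xy]
    by (simp add: complex_eq_iff del: of_real_power)
  moreover have "Re (cinner H x y) \<le> hnorm H x * hnorm H y"
    using complex_Re_le_cmod Cauchy_Schwarz[OF x y] by (rule order_trans)
  ultimately show "(hnorm H (x \<oplus>\<^bsub>H\<^esub> y))\<^sup>2 \<le> (hnorm H x + hnorm H y)\<^sup>2"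
    by (simp add: power2_sum)
  show "0 \<le> hnorm H x + hnorm H y" using x y hnorm_nonneg by simp
qed

sublocale Metric_space "carrier H" "hdist H"
proof
  fix x y z
  show "0 \<le> hdist H x y" by (simp add: hdist_def hnorm_nonneg M.minus_closed)
  have "cinner H (x \<ominus>\<^bsub>H\<^esub> y) (x \<ominus>\<^bsub>H\<^esub> y) = cinner H (y \<ominus>\<^bsub>H\<^esub> x) (y \<ominus>\<^bsub>H\<^esub> x)"
    if "x \<in> carrier H" "y \<in> carrier H"
    using that by (simp add: cinner_minus_left cinner_minus_right M.minus_closed algebra_simps)
  then show "hdist H x y = hdist H y x" by (simp add: hdist_def hnorm_def)
  assume x: "x \<in> carrier H" and y: "y \<in> carrier H"
  have "x \<ominus>\<^bsub>H\<^esub> y = \<zero>\<^bsub>H\<^esub> \<longleftrightarrow> x = y"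
    using x y by (metis M.add.inv_closed M.minus_eq M.minus_equality M.minus_minus M.r_neg)
  then show "hdist H x y = 0 \<longleftrightarrow> x = y"
    using x y by (simp add: hdist_def hnorm_eq_0 M.minus_closed)
  assume z: "z \<in> carrier H"
  have "x \<ominus>\<^bsub>H\<^esub> z = (x \<ominus>\<^bsub>H\<^esub> y) \<oplus>\<^bsub>H\<^esub> (y \<ominus>\<^bsub>H\<^esub> z)"
    using x y z by (simp add: M.minus_eq M.a_assoc M.r_neg1)
  then show "hdist H x z \<le> hdist H x y + hdist H y z"
    using hnorm_triangle[of "x \<ominus>\<^bsub>H\<^esub> y" "y \<ominus>\<^bsub>H\<^esub> z"] x y z
    by (simp add: hdist_def M.minus_closed)
qed

end

locale complex_hilbert_space = complex_inner_product_space +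
  assumes complete: mcomplete

definition hclosure :: "('a, 'm) cinner_module_scheme \<Rightarrow> 'a set \<Rightarrow> 'a set" where
  "hclosure H S = Metric_space.mtopology (carrier H) (hdist H) closure_of S"

text \<open>
  Operators are functions that take the value \<open>undefined\<close> outside the carrier, so that HOL equality
  is equality of operators. Composition is accordingly the restricted \<^const>\<open>compose\<close>.
\<close>

definition bounded_ops :: "('a, 'm) cinner_module_scheme \<Rightarrow> ('a \<Rightarrow> 'a) set" where
  "bounded_ops H = {T \<in> carrier H \<rightarrow>\<^sub>E carrier H.
     (\<forall>x\<in>carrier H. \<forall>y\<in>carrier H. T (x \<oplus>\<^bsub>H\<^esub> y) = T x \<oplus>\<^bsub>H\<^esub> T y) \<and>
     (\<forall>c. \<forall>x\<in>carrier H. T (c \<odot>\<^bsub>H\<^esub> x) = c \<odot>\<^bsub>H\<^esub> T x) \<and>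
     (\<exists>K. \<forall>x\<in>carrier H. hnorm H (T x) \<le> K * hnorm H x)}"

abbreviation op_comp ::
    "('a, 'm) cinner_module_scheme \<Rightarrow> ('a \<Rightarrow> 'a) \<Rightarrow> ('a \<Rightarrow> 'a) \<Rightarrow> 'a \<Rightarrow> 'a" where
  "op_comp H S T \<equiv> compose (carrier H) S T"

definition op_pow :: "('a, 'm) cinner_module_scheme \<Rightarrow> ('a \<Rightarrow> 'a) \<Rightarrow> nat \<Rightarrow> 'a \<Rightarrow> 'a" where
  "op_pow H T k = restrict (T ^^ k) (carrier H)"

definition adjoint_op :: "('a, 'm) cinner_module_scheme \<Rightarrow> ('a \<Rightarrow> 'a) \<Rightarrow> 'a \<Rightarrow> 'a" where
  "adjoint_op H T = (THE S. S \<in> bounded_ops H \<and>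
     (\<forall>x\<in>carrier H. \<forall>y\<in>carrier H. cinner H (T x) y = cinner H x (S y)))"

definition positive_op :: "('a, 'm) cinner_module_scheme \<Rightarrow> ('a \<Rightarrow> 'a) \<Rightarrow> bool" where
  "positive_op H P \<longleftrightarrow> P \<in> bounded_ops H \<and> (\<forall>x\<in>carrier H. cinner H (P x) x \<in> \<real>\<^sub>\<ge>\<^sub>0)"

definition sqrt_op :: "('a, 'm) cinner_module_scheme \<Rightarrow> ('a \<Rightarrow> 'a) \<Rightarrow> 'a \<Rightarrow> 'a" where
  "sqrt_op H A = (THE P. positive_op H P \<and> op_comp H P P = A)"

definition abs_op :: "('a, 'm) cinner_module_scheme \<Rightarrow> ('a \<Rightarrow> 'a) \<Rightarrow> 'a \<Rightarrow> 'a" where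
  "abs_op H T = sqrt_op H (op_comp H (adjoint_op H T) T)"

definition orth_proj :: "('a, 'm) cinner_module_scheme \<Rightarrow> 'a set \<Rightarrow> 'a \<Rightarrow> 'a" where
  "orth_proj H M =
     (\<lambda>x\<in>carrier H. THE y. y \<in> M \<and> (\<forall>z\<in>M. cinner H (x \<ominus>\<^bsub>H\<^esub> y) z = 0))"

definition projection_op :: "('a, 'm) cinner_module_scheme \<Rightarrow> ('a \<Rightarrow> 'a) \<Rightarrow> bool" where
  "projection_op H P \<longleftrightarrow> P \<in> bounded_ops H \<and> op_comp H P P = P \<and> adjoint_op H P = P"

definition partial_isometry :: "('a, 'm) cinner_module_scheme \<Rightarrow> ('a \<Rightarrow> 'a) \<Rightarrow> bool" where
  "partial_isometry H U \<longleftrightarrow>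
     U \<in> bounded_ops H \<and> projection_op H (op_comp H (adjoint_op H U) U)"

definition polar_decomposition ::
    "('a, 'm) cinner_module_scheme \<Rightarrow> ('a \<Rightarrow> 'a) \<Rightarrow> ('a \<Rightarrow> 'a) \<Rightarrow> bool" where
  "polar_decomposition H T U \<longleftrightarrow>
     partial_isometry H U \<and>
     T = op_comp H U (abs_op H T) \<and>
     op_comp H (adjoint_op H U) U = orth_proj H (hclosure H (adjoint_op H T ` carrier H))"

text \<open>
  A bounded operator has exactly one polar decomposition, so the existential quantifier in the
  following definition merely names its partial isometry.
\<close>

definition n_centered :: "('a, 'm) cinner_module_scheme \<Rightarrow> ('a \<Rightarrow> 'a) \<Rightarrow> nat \<Rightarrow> bool" where
  "n_centered H T n \<longleftrightarrow> 0 < n \<and>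
     (\<exists>U. polar_decomposition H T U \<and>
       (\<forall>k\<in>{1..n}. polar_decomposition H (op_pow H T k) (op_pow H U k)))"

end

theory Submission
  imports Defs
begin

text \<open>
  For a partial isometry \<open>T\<close> one has \<open>|T| = T\<^sup>* T\<close>, and \<open>T = T |T|\<close> is its polar decomposition.
  The polar factor being unique, \<open>T\<close> is \<open>n\<close>-centered exactly if \<open>T, T\<^sup>2, \<dots>, T\<^sup>n\<close> are partial
  isometries (\<open>n_centered_partial_isometry_iff\<close>). So it suffices to find a partial isometry whose
  powers cease to be partial isometries precisely at exponent \<open>n + 1\<close>.

  Such an operator exists on the space with orthonormal basis \<open>e\<^sub>0, \<dots>, e\<^bsub>2n+1\<^esub>\<close>. It moves along two
  chains, \<open>e\<^sub>0 \<mapsto> e\<^sub>2 \<mapsto> \<dots> \<mapsto> e\<^bsub>2n\<^esub>\<close> and \<open>e\<^sub>1 \<mapsto> e\<^sub>3 \<mapsto> \<dots> \<mapsto> e\<^bsub>2n-1\<^esub>\<close>, and merges their ends into one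
  vector, which it then annihilates:
  \<open>e\<^bsub>2n-1\<^esub> \<mapsto> 4/5 e\<^bsub>2n+1\<^esub>\<close>, \<open>e\<^bsub>2n\<^esub> \<mapsto> 3/5 e\<^bsub>2n+1\<^esub>\<close>, \<open>e\<^bsub>2n+1\<^esub> \<mapsto> 0\<close>.
  The basis vectors that reach \<open>e\<^bsub>2n+1\<^esub>\<close> in exactly \<open>k\<close> steps are \<open>e\<^bsub>2n+1-2k\<^esub>\<close> and \<open>e\<^bsub>2n+2-2k\<^esub>\<close>. For
  \<open>1 \<le> k \<le> n\<close> both exist, and \<open>T\<^sup>k\<close> maps their span onto a line by a functional of norm \<open>1\<close>,
  because \<open>(4/5)\<^sup>2 + (3/5)\<^sup>2 = 1\<close>; the earlier basis vectors are merely shifted and the later ones are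
  killed, so \<open>T\<^sup>k\<close> is a partial isometry. But the even chain starts one step earlier: for \<open>k = n + 1\<close> only
  \<open>e\<^sub>0\<close> is left, and \<open>T\<^bsup>n+1\<^esup>\<close> is \<open>3/5\<close> times a nonzero partial isometry.
\<close>

section \<open>Adjoints and projections in an inner product space\<close>

text \<open>
  The constant \<^const>\<open>adjoint_op\<close> is a definite description and carries information only where an
  adjoint exists; this relation states existence and the adjoint together.
\<close>

definition adjoint_pair ::
    "('a, 'm) cinner_module_scheme \<Rightarrow> ('a \<Rightarrow> 'a) \<Rightarrow> ('a \<Rightarrow> 'a) \<Rightarrow> bool" where
  "adjoint_pair H T S \<longleftrightarrow> T \<in> bounded_ops H \<and> S \<in> bounded_ops H \<and>
     (\<forall>x\<in>carrier H. \<forall>y\<in>carrier H. cinner H (T x) y = cinner H x (S y))"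

context complex_inner_product_space
begin

lemma minus_add_cancel:
  "x \<in> carrier H \<Longrightarrow> y \<in> carrier H \<Longrightarrow> (x \<ominus>\<^bsub>H\<^esub> y) \<oplus>\<^bsub>H\<^esub> y = x"
  by (simp add: M.minus_eq M.a_assoc M.l_neg)

lemma minus_eq_zero_iff:
  "x \<in> carrier H \<Longrightarrow> y \<in> carrier H \<Longrightarrow> x \<ominus>\<^bsub>H\<^esub> y = \<zero>\<^bsub>H\<^esub> \<longleftrightarrow> x = y"
  using minus_add_cancel[of x y] by (auto simp: M.minus_eq M.r_neg)

lemma cinner_zero_left: "x \<in> carrier H \<Longrightarrow> cinner H \<zero>\<^bsub>H\<^esub> x = 0"
  using cinner_add_left[of "\<zero>\<^bsub>H\<^esub>" "\<zero>\<^bsub>H\<^esub>" x] by simp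

lemma cinner_zero_right: "x \<in> carrier H \<Longrightarrow> cinner H x \<zero>\<^bsub>H\<^esub> = 0"
  using cinner_commute[of x "\<zero>\<^bsub>H\<^esub>"] by (simp add: cinner_zero_left)

lemma cinner_add_right:
  "\<lbrakk>x \<in> carrier H; y \<in> carrier H; z \<in> carrier H\<rbrakk> \<Longrightarrow>
    cinner H z (x \<oplus>\<^bsub>H\<^esub> y) = cinner H z x + cinner H z y"
  using cinner_commute[of z] cinner_add_left[of x y z] by simp

lemma cinner_eqI:
  assumes "x \<in> carrier H" "y \<in> carrier H"
    and "\<And>z. z \<in> carrier H \<Longrightarrow> cinner H z x = cinner H z y"
  shows "x = y"
proof -
  have "cinner H (x \<ominus>\<^bsub>H\<^esub> y) (x \<ominus>\<^bsub>H\<^esub> y) = 0"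
    using assms by (simp add: cinner_minus_right M.minus_closed)
  then have "x \<ominus>\<^bsub>H\<^esub> y = \<zero>\<^bsub>H\<^esub>"
    using assms by (intro cinner_definite) (simp_all add: M.minus_closed)
  then show ?thesis using assms by (simp add: minus_eq_zero_iff)
qed

lemma smult_zero_right: "c \<odot>\<^bsub>H\<^esub> \<zero>\<^bsub>H\<^esub> = \<zero>\<^bsub>H\<^esub>"
  by (rule smult_r_null) (simp add: ring_of_type_algebra_def)

lemma bounded_ops_closed: "T \<in> bounded_ops H \<Longrightarrow> x \<in> carrier H \<Longrightarrow> T x \<in> carrier H"
  by (auto simp: bounded_ops_def)

lemma bounded_ops_add:
  "\<lbrakk>T \<in> bounded_ops H; x \<in> carrier H; y \<in> carrier H\<rbrakk> \<Longrightarrow> T (x \<oplus>\<^bsub>H\<^esub> y) = T x \<oplus>\<^bsub>H\<^esub> T y"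
  by (auto simp: bounded_ops_def)

lemma bounded_ops_smult:
  "\<lbrakk>T \<in> bounded_ops H; x \<in> carrier H\<rbrakk> \<Longrightarrow> T (c \<odot>\<^bsub>H\<^esub> x) = c \<odot>\<^bsub>H\<^esub> T x"
  by (auto simp: bounded_ops_def)

lemma bounded_ops_minus:
  assumes "T \<in> bounded_ops H" "x \<in> carrier H" "y \<in> carrier H"
  shows "T (x \<ominus>\<^bsub>H\<^esub> y) = T x \<ominus>\<^bsub>H\<^esub> T y"
proof -
  have "T (x \<ominus>\<^bsub>H\<^esub> y) \<oplus>\<^bsub>H\<^esub> T y = (T x \<ominus>\<^bsub>H\<^esub> T y) \<oplus>\<^bsub>H\<^esub> T y"
    using assms bounded_ops_add[of T "x \<ominus>\<^bsub>H\<^esub> y" y]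
    by (simp add: minus_add_cancel M.minus_closed bounded_ops_closed)
  then show ?thesis
    using assms by (simp add: M.minus_closed bounded_ops_closed)
qed

lemma bounded_opsE:
  assumes "T \<in> bounded_ops H"
  obtains K where "0 \<le> K" "\<And>x. x \<in> carrier H \<Longrightarrow> hnorm H (T x) \<le> K * hnorm H x"
proof -
  have "\<exists>K. \<forall>x\<in>carrier H. hnorm H (T x) \<le> K * hnorm H x"
    using assms by (simp add: bounded_ops_def)
  then obtain K where K: "\<And>x. x \<in> carrier H \<Longrightarrow> hnorm H (T x) \<le> K * hnorm H x" by blast
  have "hnorm H (T x) \<le> \<bar>K\<bar> * hnorm H x" if "x \<in> carrier H" for x
    using K[OF that] mult_right_mono[OF abs_ge_self hnorm_nonneg[OF that], of K] by linarith
  then show ?thesis using that[of "\<bar>K\<bar>"] by simp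
qed

lemma bounded_ops_ext:
  assumes "S \<in> bounded_ops H" "T \<in> bounded_ops H" "\<And>x. x \<in> carrier H \<Longrightarrow> S x = T x"
  shows "S = T"
  using assms by (auto simp: bounded_ops_def intro: PiE_ext)

lemma bounded_ops_compose:
  assumes S: "S \<in> bounded_ops H" and T: "T \<in> bounded_ops H"
  shows "op_comp H S T \<in> bounded_ops H"
proof -
  obtain K where K: "0 \<le> K" "\<And>x. x \<in> carrier H \<Longrightarrow> hnorm H (S x) \<le> K * hnorm H x"
    using S by (rule bounded_opsE) auto
  obtain L where L: "\<And>x. x \<in> carrier H \<Longrightarrow> hnorm H (T x) \<le> L * hnorm H x"
    using T by (rule bounded_opsE) auto
  have "hnorm H (S (T x)) \<le> (K * L) * hnorm H x" if x: "x \<in> carrier H" for x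
    using K(2)[OF bounded_ops_closed[OF T x]] mult_left_mono[OF L[OF x] K(1)]
    by (simp add: mult.assoc)
  then have "\<exists>K. \<forall>x\<in>carrier H. hnorm H (op_comp H S T x) \<le> K * hnorm H x"
    by (auto simp: compose_def)
  then show ?thesis
    unfolding bounded_ops_def
    using S T by (auto simp: compose_eq bounded_ops_add bounded_ops_smult bounded_ops_closed
        smult_closed' compose_def)
qed

lemma adjoint_op_eq:
  assumes "adjoint_pair H T S"
  shows "adjoint_op H T = S"
  unfolding adjoint_op_def
proof (rule the_equality)
  show "S \<in> bounded_ops H \<and>
      (\<forall>x\<in>carrier H. \<forall>y\<in>carrier H. cinner H (T x) y = cinner H x (S y))"
    using assms by (simp add: adjoint_pair_def)
  fix S'
  assume S': "S' \<in> bounded_ops H \<and>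
      (\<forall>x\<in>carrier H. \<forall>y\<in>carrier H. cinner H (T x) y = cinner H x (S' y))"
  then have "S' y = S y" if "y \<in> carrier H" for y
    using assms that by (intro cinner_eqI) (auto simp: adjoint_pair_def bounded_ops_closed)
  then show "S' = S" using S' assms by (auto simp: adjoint_pair_def intro: bounded_ops_ext)
qed

lemma adjoint_pair_commute:
  assumes "adjoint_pair H T S"
  shows "adjoint_pair H S T"
proof -
  have "cinner H (S x) y = cinner H x (T y)" if "x \<in> carrier H" "y \<in> carrier H" for x y
    using assms that cinner_commute[of "S x" y] cinner_commute[of x "T y"]
    by (auto simp: adjoint_pair_def bounded_ops_closed)
  then show ?thesis using assms by (simp add: adjoint_pair_def)
qed

lemma adjoint_pair_compose:
  assumes "adjoint_pair H T S" "adjoint_pair H T' S'"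
  shows "adjoint_pair H (op_comp H T T') (op_comp H S' S)"
  using assms unfolding adjoint_pair_def
  by (auto simp: bounded_ops_compose bounded_ops_closed compose_eq)

lemma op_pow_1: "T \<in> bounded_ops H \<Longrightarrow> op_pow H T 1 = T"
  by (auto simp: op_pow_def bounded_ops_def fun_eq_iff PiE_def extensional_def)

lemma op_pow_in_bounded_ops:
  assumes "T \<in> bounded_ops H"
  shows "op_pow H T (Suc k) \<in> bounded_ops H"
proof (induction k)
  case 0
  show ?case using assms op_pow_1[OF assms] by simp
next
  case (Suc k)
  have "op_pow H T (Suc (Suc k)) = op_comp H T (op_pow H T (Suc k))"
    by (simp add: op_pow_def compose_def fun_eq_iff)
  then show ?case using bounded_ops_compose[OF assms Suc] by simp
qed

lemma op_pow_closed: "T \<in> bounded_ops H \<Longrightarrow> x \<in> carrier H \<Longrightarrow> (T ^^ k) x \<in> carrier H"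
  by (induction k) (auto simp: bounded_ops_closed)

lemma adjoint_pair_op_pow:
  assumes "adjoint_pair H T S"
  shows "adjoint_pair H (op_pow H T (Suc k)) (op_pow H S (Suc k))"
proof -
  have TS: "T \<in> bounded_ops H" "S \<in> bounded_ops H" using assms by (auto simp: adjoint_pair_def)
  have "cinner H ((T ^^ k) x) y = cinner H x ((S ^^ k) y)"
    if "x \<in> carrier H" "y \<in> carrier H" for k x y
    using that
  proof (induction k arbitrary: x)
    case (Suc k)
    then show ?case
      using TS assms
      by (simp add: adjoint_pair_def bounded_ops_closed op_pow_closed funpow_swap1[of T])
  qed simp
  then show ?thesis
    using TS unfolding adjoint_pair_def
    by (simp add: op_pow_in_bounded_ops) (simp add: op_pow_def del: funpow.simps)
qed

text \<open>
  Uniqueness of the square root needs no functional calculus here. If \<open>Q\<close> is positive and \<open>Q\<^sup>2 = E\<close>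
  is a projection, then \<open>Q\<close> is determined on the two eigenspaces of \<open>E\<close>: it vanishes on the kernel and
  is the identity on the range, in both cases because otherwise \<open>\<langle>Q x, x\<rangle>\<close> would become negative.
\<close>

lemma sqrt_op_projection:
  assumes E: "adjoint_pair H E E" and idem: "op_comp H E E = E"
  shows "sqrt_op H E = E"
  unfolding sqrt_op_def
proof (rule the_equality)
  have bE: "E \<in> bounded_ops H" using E by (simp add: adjoint_pair_def)
  have EE: "E (E x) = E x" if "x \<in> carrier H" for x
    using fun_cong[OF idem, of x] that by (simp add: compose_eq)
  have "cinner H (E x) x \<in> \<real>\<^sub>\<ge>\<^sub>0" if x: "x \<in> carrier H" for x
  proof -
    have "cinner H (E x) x = cinner H (E x) (E x)"
      using E x bE EE[OF x] bounded_ops_closed[OF bE x] unfolding adjoint_pair_def by metis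
    then show ?thesis using cinner_nonneg bounded_ops_closed[OF bE x] by simp
  qed
  then show "positive_op H E \<and> op_comp H E E = E"
    using idem bE by (simp add: positive_op_def)
  fix Q
  assume "positive_op H Q \<and> op_comp H Q Q = E"
  then have bQ: "Q \<in> bounded_ops H" and QQ: "op_comp H Q Q = E"
    and pos: "\<And>x. x \<in> carrier H \<Longrightarrow> cinner H (Q x) x \<in> \<real>\<^sub>\<ge>\<^sub>0"
    by (auto simp: positive_op_def)
  have Q2: "Q (Q x) = E x" if "x \<in> carrier H" for x
    using fun_cong[OF QQ, of x] that by (simp add: compose_eq)
  note cl = bounded_ops_closed[OF bE] bounded_ops_closed[OF bQ] M.minus_closed smult_closed'
  have ker: "Q z = \<zero>\<^bsub>H\<^esub>" if z: "z \<in> carrier H" and Ez: "E z = \<zero>\<^bsub>H\<^esub>" for z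
  proof -
    \<comment> \<open>Since \<open>Q (Q z) = 0\<close>, this is the form \<open>\<langle>Q w, w\<rangle>\<close> at \<open>w = z - s Q z\<close>; letting \<open>s\<close> grow
      forces \<open>Q z = 0\<close>.\<close>
    have "0 \<le> Re (cinner H (Q z) z) - s * (hnorm H (Q z))\<^sup>2" for s
    proof -
      let ?w = "z \<oplus>\<^bsub>H\<^esub> complex_of_real (- s) \<odot>\<^bsub>H\<^esub> Q z"
      have "Q (complex_of_real (- s) \<odot>\<^bsub>H\<^esub> Q z) = \<zero>\<^bsub>H\<^esub>"
        using z Ez bQ cl by (simp add: bounded_ops_smult Q2 smult_zero_right)
      then have "Q ?w = Q z" using z bQ cl by (simp add: bounded_ops_add)
      moreover have "cinner H (Q z) ?w = cinner H (Q z) z - of_real s * cinner H (Q z) (Q z)"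
        using z cl by (simp add: cinner_add_right cinner_smult_right)
      ultimately have "cinner H (Q ?w) ?w = cinner H (Q z) z - of_real (s * (hnorm H (Q z))\<^sup>2)"
        using z cl by (simp add: cinner_self)
      then show ?thesis
        using pos[of ?w] z cl by (simp add: complex_nonneg_Reals_iff)
    qed
    note this[of "(Re (cinner H (Q z) z) + 1) / (hnorm H (Q z))\<^sup>2"]
    then have "hnorm H (Q z) = 0" by (cases "hnorm H (Q z) = 0") simp_all
    then show ?thesis using hnorm_eq_0 z cl by simp
  qed
  have fixed: "Q z = z" if z: "z \<in> carrier H" and Ez: "E z = z" for z
  proof -
    \<comment> \<open>The defect is an eigenvector of \<open>Q\<close> for the eigenvalue \<open>-1\<close>.\<close>
    let ?v = "Q z \<ominus>\<^bsub>H\<^esub> z"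
    have v: "?v \<in> carrier H" using z cl by simp
    have "Q ?v = z \<ominus>\<^bsub>H\<^esub> Q z" using z cl bQ Ez by (simp add: bounded_ops_minus Q2)
    then have "cinner H (Q ?v) ?v = - cinner H ?v ?v"
      using z cl by (simp add: cinner_minus_left cinner_minus_right)
    then have "(hnorm H ?v)\<^sup>2 \<le> 0"
      using pos[OF v] cinner_self[OF v] by (simp add: complex_nonneg_Reals_iff)
    then have "?v = \<zero>\<^bsub>H\<^esub>" using hnorm_eq_0[OF v] by simp
    then show ?thesis using minus_eq_zero_iff z cl by simp
  qed
  have "Q x = E x" if x: "x \<in> carrier H" for x
  proof -
    have "E (x \<ominus>\<^bsub>H\<^esub> E x) = \<zero>\<^bsub>H\<^esub>"
      using x cl bE by (simp add: bounded_ops_minus EE minus_eq_zero_iff)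
    then have "Q (x \<ominus>\<^bsub>H\<^esub> E x) = \<zero>\<^bsub>H\<^esub>" using ker x cl by simp
    moreover have "Q (E x) = E x" using fixed EE x cl by simp
    ultimately have "Q ((x \<ominus>\<^bsub>H\<^esub> E x) \<oplus>\<^bsub>H\<^esub> E x) = E x"
      using x cl bQ by (simp add: bounded_ops_add)
    then show ?thesis using x cl by (simp add: minus_add_cancel)
  qed
  then show "Q = E" using bQ bE by (intro bounded_ops_ext)
qed

text \<open>
  The range is closed as the set of fixed points of \<open>E\<close>: if \<open>E z\<close> is close to \<open>x\<close>, then so is \<open>E x\<close>,
  by continuity.
\<close>

lemma hclosure_range_projection:
  assumes bE: "E \<in> bounded_ops H" and EE: "\<And>x. x \<in> carrier H \<Longrightarrow> E (E x) = E x"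
  shows "hclosure H (E ` carrier H) = E ` carrier H"
proof
  note cl = bounded_ops_closed[OF bE] M.minus_closed
  show "E ` carrier H \<subseteq> hclosure H (E ` carrier H)"
    unfolding hclosure_def by (rule closure_of_subset) (auto simp: cl)
  obtain K where K: "0 \<le> K" "\<And>x. x \<in> carrier H \<Longrightarrow> hnorm H (E x) \<le> K * hnorm H x"
    using bE by (rule bounded_opsE) auto
  show "hclosure H (E ` carrier H) \<subseteq> E ` carrier H"
  proof
    fix x
    assume "x \<in> hclosure H (E ` carrier H)"
    then have x: "x \<in> carrier H"
      and appr: "\<And>r. r > 0 \<Longrightarrow> \<exists>z\<in>carrier H. hnorm H (x \<ominus>\<^bsub>H\<^esub> E z) < r"
      unfolding hclosure_def metric_closure_of by (fastforce simp: hdist_def cl)+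
    have "hnorm H (E x \<ominus>\<^bsub>H\<^esub> x) \<le> (K + 1) * r" if r: "r > 0" for r
    proof -
      obtain z where z: "z \<in> carrier H" "hnorm H (x \<ominus>\<^bsub>H\<^esub> E z) < r" using appr r by blast
      have "hdist H (E x) x \<le> hdist H (E x) (E z) + hdist H (E z) x"
        using x z cl by (intro triangle) auto
      moreover have "hdist H (E x) (E z) \<le> K * r"
      proof -
        have "hdist H (E x) (E z) = hnorm H (E (x \<ominus>\<^bsub>H\<^esub> E z))"
          using x z cl bE by (simp add: hdist_def bounded_ops_minus EE)
        also have "\<dots> \<le> K * r"
          using K(2)[of "x \<ominus>\<^bsub>H\<^esub> E z"] mult_left_mono[OF less_imp_le[OF z(2)] K(1)] x z cl by simp
        finally show ?thesis .
      qed
      moreover have "hdist H (E z) x < r"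
        using z x cl commute[of "E z" x] by (simp add: hdist_def)
      ultimately show ?thesis using x cl by (simp add: hdist_def algebra_simps)
    qed
    note bound = this
    have "hnorm H (E x \<ominus>\<^bsub>H\<^esub> x) \<le> e" if "e > 0" for e
      using bound[of "e / (K + 1)"] that K(1) by simp
    then have "hnorm H (E x \<ominus>\<^bsub>H\<^esub> x) \<le> 0" by (rule field_le_epsilon[of _ 0, simplified])
    then have "E x \<ominus>\<^bsub>H\<^esub> x = \<zero>\<^bsub>H\<^esub>"
      using hnorm_nonneg[of "E x \<ominus>\<^bsub>H\<^esub> x"] hnorm_eq_0[of "E x \<ominus>\<^bsub>H\<^esub> x"] x cl by force
    then have "x = E x" using minus_eq_zero_iff x cl by simp
    then show "x \<in> E ` carrier H" using x by blast
  qed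
qed

lemma orth_proj_range:
  assumes E: "adjoint_pair H E E" and EE: "\<And>x. x \<in> carrier H \<Longrightarrow> E (E x) = E x"
  shows "orth_proj H (E ` carrier H) = E"
proof (rule PiE_ext)
  have bE: "E \<in> bounded_ops H" using E by (simp add: adjoint_pair_def)
  note cl = bounded_ops_closed[OF bE] M.minus_closed
  have adj: "cinner H (E x) y = cinner H x (E y)" if "x \<in> carrier H" "y \<in> carrier H" for x y
    using E that by (simp add: adjoint_pair_def)
  have orth: "cinner H (x \<ominus>\<^bsub>H\<^esub> E x) (E z) = 0" if "x \<in> carrier H" "z \<in> carrier H" for x z
    using that cl bE adj[of "x \<ominus>\<^bsub>H\<^esub> E x" z]
    by (simp add: bounded_ops_minus EE minus_eq_zero_iff[THEN iffD2] cinner_zero_left)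
  have the: "(THE y. y \<in> E ` carrier H \<and> (\<forall>z\<in>E ` carrier H. cinner H (x \<ominus>\<^bsub>H\<^esub> y) z = 0)) = E x"
    if x: "x \<in> carrier H" for x
  proof (rule the_equality)
    show "E x \<in> E ` carrier H \<and> (\<forall>z\<in>E ` carrier H. cinner H (x \<ominus>\<^bsub>H\<^esub> E x) z = 0)"
      using orth x by auto
    fix y
    assume y: "y \<in> E ` carrier H \<and> (\<forall>z\<in>E ` carrier H. cinner H (x \<ominus>\<^bsub>H\<^esub> y) z = 0)"
    then have yc: "y \<in> carrier H" and Ey: "E y = y" using EE cl by auto
    have "cinner H z (E x) = cinner H z y" if z: "z \<in> carrier H" for z
    proof -
      have "cinner H (E (x \<ominus>\<^bsub>H\<^esub> y)) z = 0" using y z x yc cl adj by auto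
      then have "cinner H (E x) z = cinner H y z"
        using x yc z cl bE Ey by (simp add: bounded_ops_minus cinner_minus_left)
      then show ?thesis using cinner_commute[of z] x z yc cl by simp
    qed
    then show "y = E x" using x yc cl by (intro cinner_eqI[symmetric]) auto
  qed
  show "E \<in> carrier H \<rightarrow>\<^sub>E carrier H" using bE by (simp add: bounded_ops_def)
  show "orth_proj H (E ` carrier H) \<in> carrier H \<rightarrow>\<^sub>E carrier H"
    unfolding orth_proj_def by (auto simp: the cl simp del: ball_simps)
  show "orth_proj H (E ` carrier H) x = E x" if "x \<in> carrier H" for x
    using the[OF that] that by (simp only: orth_proj_def restrict_apply' )
qed

section \<open>Partial isometries and their polar decomposition\<close>

text \<open>
  With \<open>S\<close> the adjoint of \<open>T\<close>, idempotence of \<open>S T\<close> gives only \<open>S v = 0\<close> for the vector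
  \<open>v = T S T x - T x\<close>; but \<open>v\<close> lies in the range of \<open>T\<close>, which is orthogonal to the kernel of \<open>S\<close>.
\<close>

lemma partial_isometry_iff:
  assumes TS: "adjoint_pair H T S"
  shows "partial_isometry H T \<longleftrightarrow> (\<forall>x\<in>carrier H. T (S (T x)) = T x)"
proof -
  have bT: "T \<in> bounded_ops H" and bS: "S \<in> bounded_ops H"
    using TS by (auto simp: adjoint_pair_def)
  note cl = bounded_ops_closed[OF bT] bounded_ops_closed[OF bS] M.minus_closed
  have E: "adjoint_pair H (op_comp H S T) (op_comp H S T)"
    using adjoint_pair_compose[OF adjoint_pair_commute[OF TS] TS] .
  have "partial_isometry H T \<longleftrightarrow> (\<forall>x\<in>carrier H. S (T (S (T x))) = S (T x))"
    unfolding partial_isometry_def projection_op_def adjoint_op_eq[OF TS] adjoint_op_eq[OF E]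
    using bT E by (auto simp: adjoint_pair_def compose_def fun_eq_iff restrict_def cl)
  also have "\<dots> \<longleftrightarrow> (\<forall>x\<in>carrier H. T (S (T x)) = T x)"
  proof (intro ball_cong refl iffI)
    fix x
    assume x: "x \<in> carrier H" and eq: "S (T (S (T x))) = S (T x)"
    let ?u = "S (T x) \<ominus>\<^bsub>H\<^esub> x" and ?v = "T (S (T x)) \<ominus>\<^bsub>H\<^esub> T x"
    have "T ?u = ?v" using x cl bT by (simp add: bounded_ops_minus)
    then have "cinner H ?v ?v = cinner H ?u (S ?v)"
      using TS x cl by (metis adjoint_pair_def)
    also have "S ?v = \<zero>\<^bsub>H\<^esub>" using x cl bS eq by (simp add: bounded_ops_minus minus_eq_zero_iff)
    finally have "?v = \<zero>\<^bsub>H\<^esub>" using x cl by (simp add: cinner_zero_right cinner_definite)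
    then show "T (S (T x)) = T x" using x cl by (simp add: minus_eq_zero_iff)
  qed simp
  finally show ?thesis .
qed

text \<open>
  The initial projection \<open>E = S T\<close> has itself as its square root, and \<open>S T S = S\<close> shows that \<open>S\<close> and \<open>E\<close>
  have the same range. So \<open>E\<close> is at once the absolute value of \<open>T\<close> and the projection onto the closed
  range of the adjoint.
\<close>

lemma partial_isometry_polar:
  assumes TS: "adjoint_pair H T S" and T: "partial_isometry H T"
  shows abs_op_partial_isometry: "abs_op H T = op_comp H S T"
    and orth_proj_partial_isometry:
      "orth_proj H (hclosure H (adjoint_op H T ` carrier H)) = op_comp H S T"
    and polar_decomposition_self: "polar_decomposition H T T"
proof -
  have bT: "T \<in> bounded_ops H" and bS: "S \<in> bounded_ops H"
    using TS by (auto simp: adjoint_pair_def)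
  note cl = bounded_ops_closed[OF bT] bounded_ops_closed[OF bS] M.minus_closed
  let ?E = "op_comp H S T"
  have E: "adjoint_pair H ?E ?E"
    using adjoint_pair_compose[OF adjoint_pair_commute[OF TS] TS] .
  have TST: "T (S (T x)) = T x" if "x \<in> carrier H" for x
    using T that by (simp add: partial_isometry_iff[OF TS])
  have EE: "?E (?E x) = ?E x" if "x \<in> carrier H" for x
    using that by (simp add: compose_eq TST cl)
  have "op_comp H ?E ?E = ?E"
    using EE by (auto simp: compose_def fun_eq_iff)
  then show abs: "abs_op H T = ?E"
    unfolding abs_op_def adjoint_op_eq[OF TS] by (rule sqrt_op_projection[OF E])
  have STS: "S (T (S y)) = S y" if y: "y \<in> carrier H" for y
  proof (rule cinner_eqI)
    fix z
    assume z: "z \<in> carrier H"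
    have "cinner H z (S (T (S y))) = cinner H (T (S (T z))) y"
      using TS adjoint_pair_commute[OF TS] y z cl by (simp add: adjoint_pair_def)
    then show "cinner H z (S (T (S y))) = cinner H z (S y)"
      using TS y z by (simp add: TST adjoint_pair_def)
  qed (use y cl in auto)
  have "S ` carrier H = ?E ` carrier H"
  proof (intro equalityI image_subsetI)
    fix y
    assume y: "y \<in> carrier H"
    then have "S y = ?E (S y)" by (simp add: STS compose_eq cl)
    then show "S y \<in> ?E ` carrier H" using y cl by blast
    show "?E y \<in> S ` carrier H" using y cl by (simp add: compose_eq)
  qed
  then show proj: "orth_proj H (hclosure H (adjoint_op H T ` carrier H)) = ?E"
    using E EE by (simp add: adjoint_op_eq[OF TS] hclosure_range_projection orth_proj_range
        adjoint_pair_def)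
  have "T = op_comp H T ?E"
    using bT bS by (intro bounded_ops_ext bounded_ops_compose) (auto simp: compose_eq TST)
  then show "polar_decomposition H T T"
    unfolding polar_decomposition_def abs proj using T by (simp add: adjoint_op_eq[OF TS])
qed

text \<open>
  The equation \<open>T = U |T|\<close> fixes \<open>U\<close> on the range of \<open>E = S T\<close>. On the kernel of \<open>E\<close> the condition
  on the initial projection gives \<open>V U = 0\<close>, and hence \<open>U = 0\<close> by adjointness.
\<close>

lemma polar_decomposition_partial_isometry_unique:
  assumes TS: "adjoint_pair H T S" and T: "partial_isometry H T"
    and UV: "adjoint_pair H U V" and polar: "polar_decomposition H T U"
  shows "U = T"
proof -
  have bds: "T \<in> bounded_ops H" "S \<in> bounded_ops H" "U \<in> bounded_ops H" "V \<in> bounded_ops H"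
    using TS UV by (auto simp: adjoint_pair_def)
  note cl = bds[THEN bounded_ops_closed] M.minus_closed
  have "T = op_comp H U (op_comp H S T)" and "op_comp H V U = op_comp H S T"
    using polar unfolding polar_decomposition_def adjoint_op_eq[OF UV]
      orth_proj_partial_isometry[OF TS T] abs_op_partial_isometry[OF TS T] by auto
  then have UST: "T x = U (S (T x))" and VU: "V (U x) = S (T x)" if "x \<in> carrier H" for x
    using that by (metis compose_eq)+
  have "U x = T x" if x: "x \<in> carrier H" for x
  proof -
    let ?w = "x \<ominus>\<^bsub>H\<^esub> S (T x)"
    have "S (T (S (T x))) = S (T x)" using T x by (simp add: partial_isometry_iff[OF TS])
    then have "V (U ?w) = \<zero>\<^bsub>H\<^esub>"
      using x cl bds by (simp add: VU bounded_ops_minus minus_eq_zero_iff)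
    then have "cinner H (U ?w) (U ?w) = 0"
      using UV x cl by (simp add: adjoint_pair_def cinner_zero_right)
    then have "U ?w = \<zero>\<^bsub>H\<^esub>" using x cl by (simp add: cinner_definite)
    then have "U x = U (S (T x))"
      using x cl bds by (simp add: bounded_ops_minus minus_eq_zero_iff)
    then show ?thesis using UST x by simp
  qed
  then show ?thesis using bds by (intro bounded_ops_ext)
qed

text \<open>
  By uniqueness, the polar factor in \<^const>\<open>n_centered\<close> can only be \<open>T\<close> itself, which reduces
  the notion to a statement about powers. The existence of adjoints is a hypothesis because a candidate
  polar factor is an arbitrary bounded operator.
\<close>

lemma n_centered_partial_isometry_iff:
  assumes adj: "\<And>S. S \<in> bounded_ops H \<Longrightarrow> \<exists>S'. adjoint_pair H S S'"
    and T: "partial_isometry H T"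
  shows "n_centered H T n \<longleftrightarrow> 0 < n \<and> (\<forall>k\<in>{1..n}. partial_isometry H (op_pow H T k))"
proof -
  obtain S where TS: "adjoint_pair H T S" using T adj by (auto simp: partial_isometry_def)
  have bounded: "U \<in> bounded_ops H" if "polar_decomposition H A U" for A U
    using that by (simp add: polar_decomposition_def partial_isometry_def)
  have "polar_decomposition H T U \<longleftrightarrow> U = T" for U
    using polar_decomposition_self[OF TS T] polar_decomposition_partial_isometry_unique[OF TS T]
      adj[OF bounded[of T U]] by blast
  moreover have "polar_decomposition H A A \<longleftrightarrow> partial_isometry H A" for A
  proof
    show "partial_isometry H A" if "polar_decomposition H A A"
      using that by (simp add: polar_decomposition_def)
    assume A: "partial_isometry H A"
    then obtain B where "adjoint_pair H A B" using adj by (auto simp: partial_isometry_def)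
    then show "polar_decomposition H A A" using A by (rule polar_decomposition_self)
  qed
  ultimately show ?thesis by (simp add: n_centered_def)
qed

end

section \<open>The spaces of finitely many complex coordinates\<close>

text \<open>
  The dimension is a number and not a type, since it depends on \<open>n\<close>; vectors are functions that
  vanish from index \<open>m\<close> on.
\<close>

definition coord_space :: "nat \<Rightarrow> (nat \<Rightarrow> complex) cinner_module" where
  "coord_space m =
     \<lparr>carrier = {x. \<forall>i\<ge>m. x i = 0}, monoid.mult = (\<lambda>x y i. 0), one = (\<lambda>i. 0),
      zero = (\<lambda>i. 0), add = (\<lambda>x y i. x i + y i), smult = (\<lambda>c x i. c * x i),
      cinner = (\<lambda>x y. \<Sum>i<m. x i * cnj (y i))\<rparr>"

lemma coord_space_simps:
  "x \<in> carrier (coord_space m) \<longleftrightarrow> (\<forall>i\<ge>m. x i = 0)"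
  "\<zero>\<^bsub>coord_space m\<^esub> = (\<lambda>i. 0)"
  "x \<oplus>\<^bsub>coord_space m\<^esub> y = (\<lambda>i. x i + y i)"
  "c \<odot>\<^bsub>coord_space m\<^esub> x = (\<lambda>i. c * x i)"
  "cinner (coord_space m) x y = (\<Sum>i<m. x i * cnj (y i))"
  by (simp_all add: coord_space_def)

lemma cinner_coord_space_self:
  "cinner (coord_space m) x x = of_real (\<Sum>i<m. (cmod (x i))\<^sup>2)"
  by (simp add: coord_space_simps complex_norm_square[symmetric])

lemma hnorm_coord_space: "hnorm (coord_space m) x = L2_set (\<lambda>i. cmod (x i)) {..<m}"
  by (simp add: hnorm_def cinner_coord_space_self L2_set_def del: of_real_sum)

lemma abelian_group_coord_space: "abelian_group (coord_space m)"
proof (rule abelian_groupI)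
  fix x
  assume "x \<in> carrier (coord_space m)"
  then show "\<exists>y\<in>carrier (coord_space m). y \<oplus>\<^bsub>coord_space m\<^esub> x = \<zero>\<^bsub>coord_space m\<^esub>"
    by (intro bexI[of _ "\<lambda>i. - x i"]) (auto simp: coord_space_simps)
qed (auto simp: coord_space_simps)

lemma complex_inner_product_space_coord_space: "complex_inner_product_space (coord_space m)"
proof (intro complex_inner_product_space.intro complex_inner_product_space_axioms.intro)
  show "Module.module (ring_of_type_algebra :: complex ring) (coord_space m)"
    by (rule moduleI[OF cring_from_type_algebra abelian_group_coord_space])
      (auto simp: coord_space_simps ring_of_type_algebra_def algebra_simps)
  fix x
  assume "x \<in> carrier (coord_space m)" "cinner (coord_space m) x x = 0"
  then have "\<forall>i\<ge>m. x i = 0" "(\<Sum>i<m. (cmod (x i))\<^sup>2) = 0"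
    unfolding cinner_coord_space_self of_real_eq_0_iff by (simp_all add: coord_space_simps)
  then have "x i = 0" for i by (cases "i < m") (simp_all add: sum_nonneg_eq_0_iff)
  then show "x = \<zero>\<^bsub>coord_space m\<^esub>" by (simp add: coord_space_simps fun_eq_iff)
next
  show "cinner (coord_space m) x x \<in> \<real>\<^sub>\<ge>\<^sub>0" for x
    unfolding cinner_coord_space_self by (simp add: sum_nonneg del: of_real_sum)
qed (auto simp: coord_space_simps sum.distrib sum_distrib_left algebra_simps)

lemma minus_coord_space:
  assumes "x \<in> carrier (coord_space m)" "y \<in> carrier (coord_space m)"
  shows "x \<ominus>\<^bsub>coord_space m\<^esub> y = (\<lambda>i. x i - y i)"
proof -
  interpret complex_inner_product_space "coord_space m"
    by (rule complex_inner_product_space_coord_space)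
  show ?thesis
    using minus_add_cancel[OF assms] by (auto simp: coord_space_simps fun_eq_iff algebra_simps)
qed

lemma complex_hilbert_space_coord_space: "complex_hilbert_space (coord_space m)"
proof -
  interpret complex_inner_product_space "coord_space m"
    by (rule complex_inner_product_space_coord_space)
  let ?C = "carrier (coord_space m)"
  have dist: "hdist (coord_space m) x y = L2_set (\<lambda>i. cmod (x i - y i)) {..<m}"
    if "x \<in> ?C" "y \<in> ?C" for x y
    using that by (simp add: hdist_def minus_coord_space hnorm_coord_space)
  have mcomplete
    unfolding mcomplete_def
  proof (intro allI impI)
    fix \<sigma>
    assume C: "MCauchy \<sigma>"
    then have \<sigma>: "\<sigma> k \<in> ?C" for k by (auto simp: MCauchy_def)
    have "Cauchy (\<lambda>k. \<sigma> k i)" for i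
    proof (cases "i < m")
      case True
      have "cmod (\<sigma> k i - \<sigma> l i) \<le> hdist (coord_space m) (\<sigma> k) (\<sigma> l)" for k l
        unfolding dist[OF \<sigma> \<sigma>] using True by (intro member_le_L2_set) auto
      then show ?thesis
        using C unfolding MCauchy_def Cauchy_def dist_norm by (meson le_less_trans)
    next
      case False
      then show ?thesis using \<sigma> by (simp add: coord_space_simps Cauchy_def)
    qed
    then have "\<exists>l. (\<lambda>k. \<sigma> k i) \<longlonglongrightarrow> l" for i
      using Cauchy_convergent_iff convergent_def by blast
    then obtain x where x: "\<And>i. (\<lambda>k. \<sigma> k i) \<longlonglongrightarrow> x i" by metis
    have xC: "x \<in> ?C"
      unfolding coord_space_simps(1)
    proof (intro allI impI)
      fix i
      assume "m \<le> i"
      then have "(\<lambda>k. \<sigma> k i) = (\<lambda>k. 0)" using \<sigma> by (simp add: coord_space_simps(1))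
      then show "x i = 0" using x[of i] by (simp add: LIMSEQ_const_iff)
    qed
    have "(\<lambda>k. hdist (coord_space m) (\<sigma> k) x) \<longlonglongrightarrow> L2_set (\<lambda>i. cmod (x i - x i)) {..<m}"
      unfolding dist[OF \<sigma> xC] L2_set_def by (intro tendsto_intros x)
    then have "(\<lambda>k. hdist (coord_space m) (\<sigma> k) x) \<longlonglongrightarrow> 0" by (simp add: L2_set_def)
    then show "\<exists>x. limitin mtopology \<sigma> x sequentially"
      unfolding limitin_metric_dist_null using \<sigma> xC by auto
  qed
  then show ?thesis
    by (intro complex_hilbert_space.intro complex_hilbert_space_axioms.intro
        complex_inner_product_space_coord_space)
qed

abbreviation unit_vector :: "nat \<Rightarrow> nat \<Rightarrow> complex" where
  "unit_vector i \<equiv> (\<lambda>j. if j = i then 1 else 0)"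

lemma linear_coord_space_expansion:
  assumes T: "T \<in> carrier (coord_space m) \<rightarrow> carrier (coord_space m)"
    and add: "\<And>x y. x \<in> carrier (coord_space m) \<Longrightarrow> y \<in> carrier (coord_space m) \<Longrightarrow>
      T (\<lambda>i. x i + y i) = (\<lambda>i. T x i + T y i)"
    and smult: "\<And>c x. x \<in> carrier (coord_space m) \<Longrightarrow> T (\<lambda>i. c * x i) = (\<lambda>i. c * T x i)"
    and x: "x \<in> carrier (coord_space m)"
  shows "T x i = (\<Sum>j<m. x j * T (unit_vector j) i)"
proof -
  have "T x i = (\<Sum>j<k. x j * T (unit_vector j) i)" if "k \<le> m" "\<forall>j\<ge>k. x j = 0" for k x
    using that
  proof (induction k arbitrary: x)
    case 0
    then have "x = (\<lambda>i. 0 * x i)" by auto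
    then show ?case using smult[of x 0] 0 by (simp add: coord_space_simps)
  next
    case (Suc k)
    \<comment> \<open>Split off the last coordinate.\<close>
    let ?y = "x(k := 0)"
    have y: "\<forall>j\<ge>k. ?y j = 0" using Suc.prems by (auto simp: le_Suc_eq Suc_le_eq)
    have "x = (\<lambda>i. ?y i + x k * unit_vector k i)" by auto
    then have "T x = T (\<lambda>i. ?y i + x k * unit_vector k i)" by (rule arg_cong)
    also have "\<dots> = (\<lambda>i. T ?y i + T (\<lambda>i. x k * unit_vector k i) i)"
      using y Suc.prems by (intro add) (auto simp: coord_space_simps)
    also have "T (\<lambda>i. x k * unit_vector k i) = (\<lambda>i. x k * T (unit_vector k) i)"
      using Suc.prems by (intro smult) (auto simp: coord_space_simps)
    finally show ?case using Suc.IH[of ?y] y Suc.prems by (simp add: fun_eq_iff)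
  qed
  then show ?thesis using x by (simp add: coord_space_simps)
qed

lemma linear_in_bounded_ops_coord_space:
  assumes T: "T \<in> carrier (coord_space m) \<rightarrow>\<^sub>E carrier (coord_space m)"
    and add: "\<And>x y. x \<in> carrier (coord_space m) \<Longrightarrow> y \<in> carrier (coord_space m) \<Longrightarrow>
      T (\<lambda>i. x i + y i) = (\<lambda>i. T x i + T y i)"
    and smult: "\<And>c x. x \<in> carrier (coord_space m) \<Longrightarrow> T (\<lambda>i. c * x i) = (\<lambda>i. c * T x i)"
  shows "T \<in> bounded_ops (coord_space m)"
proof -
  let ?K = "\<Sum>i<m. \<Sum>j<m. cmod (T (unit_vector j) i)"
  have "hnorm (coord_space m) (T x) \<le> ?K * hnorm (coord_space m) x"
    if x: "x \<in> carrier (coord_space m)" for x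
  proof -
    have "hnorm (coord_space m) (T x) \<le> (\<Sum>i<m. cmod (T x i))"
      unfolding hnorm_coord_space by (rule L2_set_le_sum) simp
    also have "\<dots> \<le> (\<Sum>i<m. \<Sum>j<m. cmod (x j) * cmod (T (unit_vector j) i))"
    proof (rule sum_mono)
      fix i
      have "T x i = (\<Sum>j<m. x j * T (unit_vector j) i)"
        using T by (intro linear_coord_space_expansion add smult x) auto
      then show "cmod (T x i) \<le> (\<Sum>j<m. cmod (x j) * cmod (T (unit_vector j) i))"
        by (simp add: norm_mult[symmetric] norm_sum)
    qed
    also have "\<dots> \<le> (\<Sum>i<m. \<Sum>j<m. hnorm (coord_space m) x * cmod (T (unit_vector j) i))"
      unfolding hnorm_coord_space
      by (intro sum_mono mult_right_mono member_le_L2_set) auto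
    also have "\<dots> = ?K * hnorm (coord_space m) x"
      by (simp add: sum_distrib_left[symmetric] mult.commute)
    finally show ?thesis .
  qed
  then show ?thesis
    using T add smult by (auto simp: bounded_ops_def coord_space_simps(3,4))
qed

text \<open>
  The adjoint is given by the conjugate transpose of the matrix of \<open>T\<close>: coordinate \<open>j\<close> of the adjoint
  at \<open>y\<close> is the inner product of \<open>y\<close> with column \<open>j\<close>.
\<close>

lemma adjoint_exists_coord_space:
  assumes "T \<in> bounded_ops (coord_space m)"
  shows "\<exists>S. adjoint_pair (coord_space m) T S"
proof -
  let ?C = "carrier (coord_space m)"
  interpret complex_inner_product_space "coord_space m"
    by (rule complex_inner_product_space_coord_space)
  define S where "S = (\<lambda>y\<in>?C. \<lambda>j. if j < m then cinner (coord_space m) y (T (unit_vector j)) else 0)"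
  have add_C: "(\<lambda>i. x i + y i) \<in> ?C" if "x \<in> ?C" "y \<in> ?C" for x y
    using that by (simp add: coord_space_simps)
  have smult_C: "(\<lambda>i. c * x i) \<in> ?C" if "x \<in> ?C" for x c
    using that by (simp add: coord_space_simps)
  have "S \<in> bounded_ops (coord_space m)"
  proof (rule linear_in_bounded_ops_coord_space)
    show "S \<in> ?C \<rightarrow>\<^sub>E ?C" by (auto simp: S_def coord_space_simps)
  qed (auto simp: S_def add_C smult_C coord_space_simps(5) fun_eq_iff sum.distrib
      sum_distrib_left algebra_simps)
  moreover have "cinner (coord_space m) (T x) y = cinner (coord_space m) x (S y)"
    if x: "x \<in> ?C" and y: "y \<in> ?C" for x y
  proof -
    have "T x i = (\<Sum>j<m. x j * T (unit_vector j) i)" for i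
      using x bounded_ops_closed[OF assms] bounded_ops_add[OF assms] bounded_ops_smult[OF assms]
      by (intro linear_coord_space_expansion) (auto simp: coord_space_simps(3,4))
    then have "cinner (coord_space m) (T x) y
        = (\<Sum>i<m. \<Sum>j<m. x j * T (unit_vector j) i * cnj (y i))"
      by (simp add: coord_space_simps(5) sum_distrib_right)
    also have "\<dots> = (\<Sum>j<m. \<Sum>i<m. x j * T (unit_vector j) i * cnj (y i))"
      by (rule sum.swap)
    also have "\<dots> = cinner (coord_space m) x (S y)"
      using y by (simp add: S_def coord_space_simps(5) sum_distrib_left mult_ac)
    finally show ?thesis .
  qed
  ultimately show ?thesis using assms by (auto simp: adjoint_pair_def)
qed

section \<open>Two shifted chains with merging ends\<close>

text \<open>
  In coordinates, the value at \<open>2 n + 1\<close> collects the ends of both chains. The coordinates \<open>0\<close> and \<open>1\<close>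
  of an image vanish because \<open>e\<^sub>0\<close> and \<open>e\<^sub>1\<close> start the chains.
\<close>

definition merge_shift :: "nat \<Rightarrow> (nat \<Rightarrow> complex) \<Rightarrow> nat \<Rightarrow> complex" where
  "merge_shift n = (\<lambda>x\<in>carrier (coord_space (2 * n + 2)). \<lambda>i.
     if i < 2 \<or> 2 * n + 1 < i then 0
     else if i = 2 * n + 1 then 4 / 5 * x (2 * n - 1) + 3 / 5 * x (2 * n)
     else x (i - 2))"

definition merge_shift_adjoint :: "nat \<Rightarrow> (nat \<Rightarrow> complex) \<Rightarrow> nat \<Rightarrow> complex" where
  "merge_shift_adjoint n = (\<lambda>y\<in>carrier (coord_space (2 * n + 2)). \<lambda>i.
     if i + 2 \<le> 2 * n then y (i + 2)
     else if i + 2 = 2 * n + 1 then 4 / 5 * y (2 * n + 1)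
     else if i + 2 = 2 * n + 2 then 3 / 5 * y (2 * n + 1)
     else 0)"

lemma merge_shift_apply:
  "x \<in> carrier (coord_space (2 * n + 2)) \<Longrightarrow> merge_shift n x = (\<lambda>i.
     if i < 2 \<or> 2 * n + 1 < i then 0
     else if i = 2 * n + 1 then 4 / 5 * x (2 * n - 1) + 3 / 5 * x (2 * n)
     else x (i - 2))"
  by (simp add: merge_shift_def)

lemma merge_shift_adjoint_apply:
  "y \<in> carrier (coord_space (2 * n + 2)) \<Longrightarrow> merge_shift_adjoint n y = (\<lambda>i.
     if i + 2 \<le> 2 * n then y (i + 2)
     else if i + 2 = 2 * n + 1 then 4 / 5 * y (2 * n + 1)
     else if i + 2 = 2 * n + 2 then 3 / 5 * y (2 * n + 1)
     else 0)"
  by (simp add: merge_shift_adjoint_def)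

lemma adjoint_pair_merge_shift:
  assumes n: "0 < n"
  shows "adjoint_pair (coord_space (2 * n + 2)) (merge_shift n) (merge_shift_adjoint n)"
  unfolding adjoint_pair_def
proof (intro conjI ballI)
  show "merge_shift n \<in> bounded_ops (coord_space (2 * n + 2))"
    by (rule linear_in_bounded_ops_coord_space)
      (auto simp: merge_shift_def coord_space_simps(1) fun_eq_iff algebra_simps)
  show "merge_shift_adjoint n \<in> bounded_ops (coord_space (2 * n + 2))"
    by (rule linear_in_bounded_ops_coord_space)
      (auto simp: merge_shift_adjoint_def coord_space_simps(1) fun_eq_iff algebra_simps)
  fix x y
  assume xy: "x \<in> carrier (coord_space (2 * n + 2))" "y \<in> carrier (coord_space (2 * n + 2))"
  \<comment> \<open>Both sums consist of \<open>q = 2 n - 1\<close> shifted terms and the two terms of the merging.\<close>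
  define q where "q = 2 * n - 1"
  have q: "2 * n = Suc q" using n by (simp add: q_def)
  have "cinner (coord_space (2 * n + 2)) (merge_shift n x) y
      = (\<Sum>i<q. x i * cnj (y (Suc (Suc i)))) + (4 / 5 * x q + 3 / 5 * x (Suc q)) * cnj (y (q + 2))"
    using xy unfolding coord_space_simps(5)
    by (simp add: merge_shift_def q sum.lessThan_Suc_shift[of _ "Suc (Suc q)"]
        sum.lessThan_Suc_shift[of _ "Suc q"] del: sum.lessThan_Suc)
      (simp add: q)
  also have "\<dots> = cinner (coord_space (2 * n + 2)) x (merge_shift_adjoint n y)"
    using xy unfolding coord_space_simps(5)
    by (simp add: merge_shift_adjoint_def q) (simp add: algebra_simps)
  finally show "cinner (coord_space (2 * n + 2)) (merge_shift n x) y
      = cinner (coord_space (2 * n + 2)) x (merge_shift_adjoint n y)" .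
qed

text \<open>
  As long as \<open>k \<le> n\<close>, each of the two chains contains a vector that reaches \<open>e\<^bsub>2n+1\<^esub>\<close> in exactly \<open>k\<close>
  steps, and a weight is applied only in the last of these steps, so \<open>T\<^sup>k\<close> has the same shape as \<open>T\<close>.
\<close>

lemma merge_shift_funpow:
  assumes "0 < k" "k \<le> n" "x \<in> carrier (coord_space (2 * n + 2))"
  shows "(merge_shift n ^^ k) x = (\<lambda>i. if i < 2 * k \<or> 2 * n + 1 < i then 0
     else if i = 2 * n + 1 then 4 / 5 * x (2 * n + 1 - 2 * k) + 3 / 5 * x (2 * n + 2 - 2 * k)
     else x (i - 2 * k))"
  using assms
proof (induction k rule: nat_induct_non_zero)
  case 1
  then show ?case by (auto simp: merge_shift_def fun_eq_iff)
next
  case (Suc k)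
  have C: "(merge_shift n ^^ k) x \<in> carrier (coord_space (2 * n + 2))"
    using Suc by (auto simp: coord_space_simps(1))
  have "(merge_shift n ^^ Suc k) x = merge_shift n ((merge_shift n ^^ k) x)" by simp
  also have "\<dots> = (\<lambda>i. if i < 2 * Suc k \<or> 2 * n + 1 < i then 0
     else if i = 2 * n + 1 then 4 / 5 * x (2 * n + 1 - 2 * Suc k) + 3 / 5 * x (2 * n + 2 - 2 * Suc k)
     else x (i - 2 * Suc k))"
    unfolding merge_shift_apply[OF C] using Suc.IH Suc.prems Suc.hyps by (auto simp: fun_eq_iff)
  finally show ?case .
qed

lemma merge_shift_adjoint_funpow:
  assumes "0 < k" "k \<le> n" "y \<in> carrier (coord_space (2 * n + 2))"
  shows "(merge_shift_adjoint n ^^ k) y = (\<lambda>i. if i + 2 * k \<le> 2 * n then y (i + 2 * k)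
     else if i + 2 * k = 2 * n + 1 then 4 / 5 * y (2 * n + 1)
     else if i + 2 * k = 2 * n + 2 then 3 / 5 * y (2 * n + 1)
     else 0)"
  using assms
proof (induction k rule: nat_induct_non_zero)
  case 1
  then show ?case by (auto simp: merge_shift_adjoint_def fun_eq_iff)
next
  case (Suc k)
  have C: "(merge_shift_adjoint n ^^ k) y \<in> carrier (coord_space (2 * n + 2))"
    using Suc by (auto simp: coord_space_simps(1))
  have "(merge_shift_adjoint n ^^ Suc k) y = merge_shift_adjoint n ((merge_shift_adjoint n ^^ k) y)"
    by simp
  also have "\<dots> = (\<lambda>i. if i + 2 * Suc k \<le> 2 * n then y (i + 2 * Suc k)
     else if i + 2 * Suc k = 2 * n + 1 then 4 / 5 * y (2 * n + 1)
     else if i + 2 * Suc k = 2 * n + 2 then 3 / 5 * y (2 * n + 1)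
     else 0)"
    unfolding merge_shift_adjoint_apply[OF C] using Suc.IH Suc.prems Suc.hyps
    by (auto simp: fun_eq_iff)
  finally show ?case .
qed

text \<open>
  For \<open>k \<le> n\<close> the product of \<open>T\<^sup>k\<close> and its adjoint is the identity on the vectors supported on the
  coordinates from \<open>2 k\<close> to \<open>2 n + 1\<close>, which contain the range of \<open>T\<^sup>k\<close>. For \<open>k = n + 1\<close> the vector
  \<open>e\<^sub>0\<close> is mapped to \<open>3/5 e\<^bsub>2n+1\<^esub>\<close>, and going back and forth multiplies this by \<open>9/25\<close>.
\<close>

lemma partial_isometry_merge_shift_power_iff:
  assumes n: "0 < n" and k: "0 < k" "k \<le> n + 1"
  shows "partial_isometry (coord_space (2 * n + 2)) (op_pow (coord_space (2 * n + 2)) (merge_shift n) k)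
    \<longleftrightarrow> k \<le> n"
proof -
  let ?H = "coord_space (2 * n + 2)"
  let ?T = "merge_shift n" and ?S = "merge_shift_adjoint n"
  interpret complex_inner_product_space ?H
    by (rule complex_inner_product_space_coord_space)
  note TS = adjoint_pair_merge_shift[OF n]
  have closed: "(?T ^^ j) x \<in> carrier ?H" "(?S ^^ j) x \<in> carrier ?H" if "x \<in> carrier ?H" for j x
    using TS op_pow_closed that unfolding adjoint_pair_def by blast+
  obtain k' where k': "k = Suc k'" using k by (cases k) auto
  have iff: "partial_isometry ?H (op_pow ?H ?T k) \<longleftrightarrow>
      (\<forall>x\<in>carrier ?H. (?T ^^ k) ((?S ^^ k) ((?T ^^ k) x)) = (?T ^^ k) x)"
    using partial_isometry_iff[OF adjoint_pair_op_pow[OF TS, of k']] closed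
    by (simp add: k'[symmetric] op_pow_def)
  show ?thesis
  proof (cases "k \<le> n")
    case True
    have "(?T ^^ k) ((?S ^^ k) ((?T ^^ k) x)) = (?T ^^ k) x" if x: "x \<in> carrier ?H" for x
    proof -
      define z where "z = (?T ^^ k) x"
      have z: "z \<in> carrier ?H" using x closed by (simp add: z_def)
      have z0: "z i = 0" if "i < 2 * k \<or> 2 * n + 1 < i" for i
        using that merge_shift_funpow[OF k(1) True x] by (auto simp: z_def)
      have "(?T ^^ k) ((?S ^^ k) z) i = z i" for i
      proof -
        consider "i < 2 * k \<or> 2 * n + 1 < i" | "i = 2 * n + 1" | "2 * k \<le> i" "i \<le> 2 * n"
          by linarith
        then show ?thesis
        proof cases
          case 1
          then show ?thesis
            unfolding merge_shift_funpow[OF k(1) True closed(2)[OF z]] using z0 by simp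
        next
          case 2
          then have "(?T ^^ k) ((?S ^^ k) z) i =
              4 / 5 * (?S ^^ k) z (2 * n + 1 - 2 * k) + 3 / 5 * (?S ^^ k) z (2 * n + 2 - 2 * k)"
            unfolding merge_shift_funpow[OF k(1) True closed(2)[OF z]] using True by simp
          also have "\<dots> = 4 / 5 * (4 / 5 * z (2 * n + 1)) + 3 / 5 * (3 / 5 * z (2 * n + 1))"
            unfolding merge_shift_adjoint_funpow[OF k(1) True z] using True by simp
          finally show ?thesis using 2 by simp
        next
          case 3
          then have "(?T ^^ k) ((?S ^^ k) z) i = (?S ^^ k) z (i - 2 * k)"
            unfolding merge_shift_funpow[OF k(1) True closed(2)[OF z]] by simp
          also have "\<dots> = z i"
            unfolding merge_shift_adjoint_funpow[OF k(1) True z] using 3 by simp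
          finally show ?thesis .
        qed
      qed
      then have "(?T ^^ k) ((?S ^^ k) z) = z" by (rule ext)
      then show ?thesis by (simp add: z_def)
    qed
    then show ?thesis using iff True by simp
  next
    case False
    then have kn: "k = Suc n" using k by simp
    \<comment> \<open>One more step after \<open>T\<^sup>n\<close>: the odd chain is too short to contribute.\<close>
    have T: "(?T ^^ k) x = (\<lambda>i. if i = 2 * n + 1 then 3 / 5 * x 0 else 0)"
      if x: "x \<in> carrier ?H" for x
    proof
      fix i
      have "(?T ^^ k) x i = ?T ((?T ^^ n) x) i" by (simp add: kn)
      then show "(?T ^^ k) x i = (if i = 2 * n + 1 then 3 / 5 * x 0 else 0)"
        unfolding merge_shift_apply[OF closed(1)[OF x]]
        unfolding merge_shift_funpow[OF n order_refl x] using n by auto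
    qed
    have S: "(?S ^^ k) y 0 = 3 / 5 * y (2 * n + 1)" if y: "y \<in> carrier ?H" for y
    proof -
      have "(?S ^^ k) y 0 = ?S ((?S ^^ n) y) 0" by (simp add: kn)
      then show ?thesis
        unfolding merge_shift_adjoint_apply[OF closed(2)[OF y]]
        unfolding merge_shift_adjoint_funpow[OF n order_refl y] using n by simp
    qed
    have e: "unit_vector 0 \<in> carrier ?H" by (simp add: coord_space_simps(1))
    note C = closed(1)[OF e, of k]
    have 1: "(?T ^^ k) ((?S ^^ k) ((?T ^^ k) (unit_vector 0))) (2 * n + 1) = 27 / 125"
      by (simp add: T[OF closed(2)[OF C]] S[OF C]) (simp add: T[OF e])
    have 2: "(?T ^^ k) (unit_vector 0) (2 * n + 1) = 3 / 5" by (simp add: T[OF e])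
    have "(?T ^^ k) ((?S ^^ k) ((?T ^^ k) (unit_vector 0))) \<noteq> (?T ^^ k) (unit_vector 0)"
    proof
      assume "(?T ^^ k) ((?S ^^ k) ((?T ^^ k) (unit_vector 0))) = (?T ^^ k) (unit_vector 0)"
      then have "(27 / 125 :: complex) = 3 / 5" using 1 2 by metis
      then show False by simp
    qed
    then show ?thesis using iff False e by blast
  qed
qed

theorem theorem6p2:
  fixes n :: nat
  assumes "n \<ge> 2"
  shows "\<exists>(H :: (nat \<Rightarrow> complex) cinner_module) T.
           complex_hilbert_space H \<and> T \<in> bounded_ops H \<and>
           n_centered H T n \<and> \<not> n_centered H T (n + 1)"
proof -
  let ?H = "coord_space (2 * n + 2)" and ?T = "merge_shift n"
  interpret complex_inner_product_space ?H
    by (rule complex_inner_product_space_coord_space)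
  have n: "0 < n" using assms by simp
  have T: "?T \<in> bounded_ops ?H"
    using adjoint_pair_merge_shift[OF n] by (simp add: adjoint_pair_def)
  have "partial_isometry ?H ?T"
    using partial_isometry_merge_shift_power_iff[OF n, of 1] n unfolding op_pow_1[OF T] by simp
  then have iff: "n_centered ?H ?T m \<longleftrightarrow>
      0 < m \<and> (\<forall>k\<in>{1..m}. partial_isometry ?H (op_pow ?H ?T k))" for m
    by (intro n_centered_partial_isometry_iff adjoint_exists_coord_space)
  have "n_centered ?H ?T n"
    unfolding iff
  proof (intro conjI ballI n)
    fix k
    assume "k \<in> {1..n}"
    then show "partial_isometry ?H (op_pow ?H ?T k)"
      using partial_isometry_merge_shift_power_iff[OF n, of k] by (metis atLeastAtMost_iff
          le_add1 le_trans less_eq_Suc_le One_nat_def)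
  qed
  moreover have "\<not> partial_isometry ?H (op_pow ?H ?T (n + 1))"
    using partial_isometry_merge_shift_power_iff[OF n, of "n + 1"] by linarith
  then have "\<not> n_centered ?H ?T (n + 1)"
    unfolding iff by (metis atLeastAtMost_iff le_add2 order_refl)
  ultimately show ?thesis using T complex_hilbert_space_coord_space by blast
qed

end
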